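(* Let $d\ge 1$ and $I_1,\dots,I_d\ge 1$ be integers, $L=I_1I_2\cdots I_d$, and let $\mathcal{A}=(\mathcal{A}_{\mathbf{i},\mathbf{j}})$ be a real order-$2d$ tensor, with $\mathbf{i}=(i_1,\dots,i_d)$, $\mathbf{j}=(j_1,\dots,j_d)$, $1\le i_k,j_k\le I_k$, which is self-adjoint, i.e. $\mathcal{A}_{\mathbf{i},\mathbf{j}}=\mathcal{A}_{\mathbf{j},\mathbf{i}}$ for all $\mathbf{i},\mathbf{j}$. Let $\alpha$ be the vector-to-linear index bijection from multi-indices to $\{1,\dots,L\}$ and define the $L\times L$ matrix $a(n,m)=\mathcal{A}_{\alpha^{-1}(n),\alpha^{-1}(m)}$. Then $a$ is symmetric, and the tensor eigenvalue equation $\mathcal{A}\,\mathcal{U}=\lambda\,\mathcal{U}$ is equivalent to the matrix eigenvalue equation $$\sum_{m=1}^{L} a(n,m)\,u(m)=\lambda\,u(n),\qquad n=1,\dots,L,$$ in the following sense: for every scalar $\lambda\in\mathbb{R}$ and every tensor $\mathcal{U}\in\mathbb{R}^{I_1\times\cdots\times I_d}$, $(\lambda,\mathcal{U})$ satisfies the tensor equation if and only if $(\lambda,u)$ with $u(m)=\mathcal{U}_{\alpha^{-1}(m)}$ satisfies the matrix equation. In particular, the eigentensors of $\mathcal{A}$ are exactly the tensors $\mathcal{U}_{\mathbf{i}}=u(\alpha(\mathbf{i}))$ obtained from the eigenvectors $u$ of $a$.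
   Context: An order-$d$ tensor $\mathcal{U}\in\mathbb{R}^{I_1\times\cdots\times I_d}$ is a real array with entries $\mathcal{U}_{\mathbf{i}}$ indexed by multi-indices $\mathbf{i}=(i_1,\dots,i_d)$, $1\le i_k\le I_k$. An order-$2d$ tensor $\mathcal{A}$ acts on it by $(\mathcal{A}\,\mathcal{U})_{\mathbf{i}}=\sum_{\mathbf{j}}\mathcal{A}_{\mathbf{i},\mathbf{j}}\,\mathcal{U}_{\mathbf{j}}$, the sum being over all multi-indices $\mathbf{j}$. An eigentensor of $\mathcal{A}$ with eigenvalue $\lambda$ is a nonzero tensor $\mathcal{U}$ with $\mathcal{A}\,\mathcal{U}=\lambda\,\mathcal{U}$. The vector-to-linear index transformation is the bijection $\alpha(\mathbf{i})=i_1+(i_2-1)I_1+(i_3-1)I_1I_2+\cdots+(i_d-1)I_1I_2\cdots I_{d-1}$ from multi-indices onto $\{1,\dots,L\}$. *)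

theory Defs
  imports "HOL-Library.FuncSet" "Jordan_Normal_Form.Char_Poly"
begin

text \<open>
  The shape of an order-\<open>d\<close> tensor is a function \<open>I\<close>, of which only the values
  \<open>I 1, \<dots>, I d\<close> matter. Multi-indices are extensional functions on \<open>{1..d}\<close>
  and tensors are extensional functions on the multi-indices, so that equality of
  multi-indices and of tensors is equality of their entries.
\<close>

type_synonym multi_index = "nat \<Rightarrow> nat"
type_synonym tensor = "multi_index \<Rightarrow> real"

text \<open>Order-\<open>2d\<close> tensors: the two blocks of \<open>d\<close> indices are separate arguments.
  Only the entries at multi-indices are ever used.\<close>

type_synonym tensor2 = "multi_index \<Rightarrow> multi_index \<Rightarrow> real"

definition multi_indices :: "nat \<Rightarrow> (nat \<Rightarrow> nat) \<Rightarrow> multi_index set" where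
  "multi_indices d I = (\<Pi>\<^sub>E k\<in>{1..d}. {1..I k})"

definition tensors :: "nat \<Rightarrow> (nat \<Rightarrow> nat) \<Rightarrow> tensor set" where
  "tensors d I = multi_indices d I \<rightarrow>\<^sub>E UNIV"

definition zero_tensor :: "nat \<Rightarrow> (nat \<Rightarrow> nat) \<Rightarrow> tensor" where
  "zero_tensor d I = (\<lambda>i\<in>multi_indices d I. 0)"

definition scale_tensor :: "nat \<Rightarrow> (nat \<Rightarrow> nat) \<Rightarrow> real \<Rightarrow> tensor \<Rightarrow> tensor" where
  "scale_tensor d I c U = (\<lambda>i\<in>multi_indices d I. c * U i)"

definition apply_tensor :: "nat \<Rightarrow> (nat \<Rightarrow> nat) \<Rightarrow> tensor2 \<Rightarrow> tensor \<Rightarrow> tensor" where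
  "apply_tensor d I A U =
     (\<lambda>i\<in>multi_indices d I. \<Sum>j\<in>multi_indices d I. A i j * U j)"

definition self_adjoint :: "nat \<Rightarrow> (nat \<Rightarrow> nat) \<Rightarrow> tensor2 \<Rightarrow> bool" where
  "self_adjoint d I A \<longleftrightarrow>
     (\<forall>i\<in>multi_indices d I. \<forall>j\<in>multi_indices d I. A i j = A j i)"

definition eigentensor :: "nat \<Rightarrow> (nat \<Rightarrow> nat) \<Rightarrow> tensor2 \<Rightarrow> tensor \<Rightarrow> real \<Rightarrow> bool" where
  "eigentensor d I A U c \<longleftrightarrow>
     U \<in> tensors d I \<and> U \<noteq> zero_tensor d I \<and>
     apply_tensor d I A U = scale_tensor d I c U"

definition tensor_size :: "nat \<Rightarrow> (nat \<Rightarrow> nat) \<Rightarrow> nat" where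
  "tensor_size d I = (\<Prod>k=1..d. I k)"

definition linear_index :: "nat \<Rightarrow> (nat \<Rightarrow> nat) \<Rightarrow> multi_index \<Rightarrow> nat" where
  "linear_index d I i = i 1 + (\<Sum>k=2..d. (i k - 1) * (\<Prod>l\<in>{1..<k}. I l))"

definition multi_index_of :: "nat \<Rightarrow> (nat \<Rightarrow> nat) \<Rightarrow> nat \<Rightarrow> multi_index" where
  "multi_index_of d I = inv_into (multi_indices d I) (linear_index d I)"

text \<open>Linear indices run over \<open>{1..L}\<close>, whereas the rows, columns and entries of the library's
  matrices and vectors are numbered from \<open>0\<close>; hence the shifts by one below.\<close>

definition matrix_of_tensor :: "nat \<Rightarrow> (nat \<Rightarrow> nat) \<Rightarrow> tensor2 \<Rightarrow> real mat" where
  "matrix_of_tensor d I A = mat (tensor_size d I) (tensor_size d I)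
     (\<lambda>(n, m). A (multi_index_of d I (n + 1)) (multi_index_of d I (m + 1)))"

definition vec_of_tensor :: "nat \<Rightarrow> (nat \<Rightarrow> nat) \<Rightarrow> tensor \<Rightarrow> real vec" where
  "vec_of_tensor d I U = vec (tensor_size d I) (\<lambda>m. U (multi_index_of d I (m + 1)))"

definition tensor_of_vec :: "nat \<Rightarrow> (nat \<Rightarrow> nat) \<Rightarrow> real vec \<Rightarrow> tensor" where
  "tensor_of_vec d I u = (\<lambda>i\<in>multi_indices d I. u $ (linear_index d I i - 1))"

text \<open>The linear index is a bijection, so that \<^const>\<open>multi_index_of\<close> is its inverse.\<close>

lemma linear_index_Suc:
  assumes "d \<ge> 1"
  shows "linear_index (Suc d) I i = linear_index d I i + (i (Suc d) - 1) * tensor_size d I"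
proof -
  have "{2..Suc d} = insert (Suc d) {2..d}" "{1..<Suc d} = {1..d}" using assms by auto
  then show ?thesis by (simp add: linear_index_def tensor_size_def)
qed

lemma linear_index_range:
  assumes "d \<ge> 1" "\<forall>k\<in>{1..d}. 1 \<le> i k \<and> i k \<le> I k"
  shows "1 \<le> linear_index d I i \<and> linear_index d I i \<le> tensor_size d I"
  using assms
proof (induction d rule: dec_induct)
  case base
  then show ?case by (simp add: linear_index_def tensor_size_def)
next
  case (step d)
  have ih: "1 \<le> linear_index d I i" "linear_index d I i \<le> tensor_size d I"
    using step by auto
  have b: "1 \<le> i (Suc d)" "i (Suc d) \<le> I (Suc d)" using step.prems by auto
  have "linear_index (Suc d) I i \<le> tensor_size d I + (i (Suc d) - 1) * tensor_size d I"
    using ih step.hyps by (simp add: linear_index_Suc)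
  also have "\<dots> = i (Suc d) * tensor_size d I"
    using b(1) by (cases "i (Suc d)") auto
  also have "\<dots> \<le> I (Suc d) * tensor_size d I" using b by simp
  also have "\<dots> = tensor_size (Suc d) I" by (simp add: tensor_size_def)
  finally show ?case using ih step.hyps by (simp add: linear_index_Suc)
qed

lemma linear_index_eqD:
  assumes "d \<ge> 1" "\<forall>k\<in>{1..d}. 1 \<le> i k \<and> i k \<le> I k" "\<forall>k\<in>{1..d}. 1 \<le> j k \<and> j k \<le> I k"
    and "linear_index d I i = linear_index d I j"
  shows "\<forall>k\<in>{1..d}. i k = j k"
  using assms
proof (induction d rule: dec_induct)
  case base
  then show ?case by (simp add: linear_index_def)
next
  case (step d)
  define L where "L = tensor_size d I"
  have ri: "1 \<le> linear_index d I i" "linear_index d I i \<le> L"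
    and rj: "1 \<le> linear_index d I j" "linear_index d I j \<le> L"
    using step.prems step.hyps linear_index_range[of d i I] linear_index_range[of d j I]
    by (auto simp: L_def)
  define p where "p = linear_index d I i - 1"
  define q where "q = linear_index d I j - 1"
  have pq: "p < L" "q < L" using ri rj by (auto simp: p_def q_def)
  have eq: "p + (i (Suc d) - 1) * L = q + (j (Suc d) - 1) * L"
    using step.prems(3) step.hyps ri rj by (simp add: linear_index_Suc L_def p_def q_def)
  have "p = q" using arg_cong[OF eq, of "\<lambda>x. x mod L"] pq by simp
  moreover have "i (Suc d) - 1 = j (Suc d) - 1"
    using arg_cong[OF eq, of "\<lambda>x. x div L"] pq by simp
  moreover have "1 \<le> i (Suc d)" "1 \<le> j (Suc d)" using step.prems by auto
  ultimately have "linear_index d I i = linear_index d I j" "i (Suc d) = j (Suc d)"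
    using ri rj by (auto simp: p_def q_def)
  moreover from this(1) have "\<forall>k\<in>{1..d}. i k = j k"
    using step.IH step.prems(1,2) by simp
  ultimately show ?case by (metis atLeastAtMost_iff le_Suc_eq)
qed

lemma bij_betw_linear_index:
  assumes "d \<ge> 1"
  shows "bij_betw (linear_index d I) (multi_indices d I) {1..tensor_size d I}"
proof -
  have bounds: "\<forall>k\<in>{1..d}. 1 \<le> i k \<and> i k \<le> I k" if "i \<in> multi_indices d I" for i
    using that by (auto simp: multi_indices_def PiE_iff)
  have inj: "inj_on (linear_index d I) (multi_indices d I)"
  proof (rule inj_onI)
    fix i j assume *: "i \<in> multi_indices d I" "j \<in> multi_indices d I"
      "linear_index d I i = linear_index d I j"
    have "\<forall>k\<in>{1..d}. i k = j k"
      using linear_index_eqD[OF assms] bounds * by blast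
    then show "i = j" using *(1,2) unfolding multi_indices_def by (auto intro: PiE_ext)
  qed
  have sub: "linear_index d I ` multi_indices d I \<subseteq> {1..tensor_size d I}"
    using linear_index_range[OF assms] bounds by fastforce
  have "card (multi_indices d I) = tensor_size d I"
    by (simp add: multi_indices_def tensor_size_def card_PiE)
  then have "linear_index d I ` multi_indices d I = {1..tensor_size d I}"
    using sub inj by (intro card_subset_eq) (auto simp: card_image)
  with inj show ?thesis by (simp add: bij_betw_def)
qed

end

theory Submission
  imports Defs
begin

text \<open>
  Vectorization is a linear bijection from the tensors onto the vectors of dimension \<open>L\<close>, and
  reindexing the contraction sum along the linear index shows that it intertwines the tensor
  action with the matrix action. Eigenpairs therefore correspond.
\<close>

text \<open>The inverse of the linear index, precomposed with a shift from 0-based vector positions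
  to linear indices starting at 1. It serves both to reindex contraction sums and to reach every
  multi-index from some position.\<close>

lemma bij_betw_multi_index_of:
  assumes "d \<ge> 1"
  shows "bij_betw (\<lambda>m. multi_index_of d I (m + 1)) {0..<tensor_size d I} (multi_indices d I)"
proof -
  have "bij_betw (multi_index_of d I) {1..tensor_size d I} (multi_indices d I)"
    unfolding multi_index_of_def by (rule bij_betw_inv_into[OF bij_betw_linear_index[OF assms]])
  moreover have "bij_betw (\<lambda>m. m + 1) {0..<tensor_size d I} {1..tensor_size d I}"
    \<comment> \<open>Truncated subtraction inverts the shift here because the target interval
      starts at 1.\<close>
    by (rule bij_betw_byWitness[where f' = "\<lambda>m. m - 1"]) auto
  ultimately have "bij_betw (multi_index_of d I \<circ> (\<lambda>m. m + 1)) {0..<tensor_size d I} (multi_indices d I)"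
    by (rule bij_betw_trans[rotated])
  then show ?thesis by (simp only: comp_def)
qed

lemma multi_index_of_in_multi_indices:
  assumes "d \<ge> 1" "m < tensor_size d I"
  shows "multi_index_of d I (m + 1) \<in> multi_indices d I"
  using bij_betwE[OF bij_betw_multi_index_of[OF assms(1)]] assms(2) by auto

lemma linear_index_multi_index_of:
  assumes "d \<ge> 1" "m < tensor_size d I"
  shows "linear_index d I (multi_index_of d I (m + 1)) = m + 1"
  unfolding multi_index_of_def
  using bij_betw_inv_into_right[OF bij_betw_linear_index[OF assms(1)]] assms(2) by simp

lemma dim_vec_of_tensor [simp]: "dim_vec (vec_of_tensor d I U) = tensor_size d I"
  by (simp add: vec_of_tensor_def)

text \<open>Every multi-index comes from a vector position, and tensors are extensional, so the
  vector determines the tensor. Tensor equations can thus be tested after vectorization.\<close>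

lemma inj_on_vec_of_tensor:
  assumes "d \<ge> 1"
  shows "inj_on (vec_of_tensor d I) (tensors d I)"
proof (rule inj_onI)
  fix U V assume U: "U \<in> tensors d I" and V: "V \<in> tensors d I"
    and eq: "vec_of_tensor d I U = vec_of_tensor d I V"
  have "U i = V i" if "i \<in> multi_indices d I" for i
  proof -
    have "i \<in> (\<lambda>m. multi_index_of d I (m + 1)) ` {0..<tensor_size d I}"
      using that by (simp only: bij_betw_imp_surj_on[OF bij_betw_multi_index_of[OF assms]])
    then obtain m where "m < tensor_size d I" "i = multi_index_of d I (m + 1)" by auto
    then show ?thesis using arg_cong[OF eq, of "\<lambda>v. v $ m"] by (simp add: vec_of_tensor_def)
  qed
  then show "U = V" using U V unfolding tensors_def by (auto intro: PiE_ext)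
qed

lemma tensor_of_vec_in_tensors: "tensor_of_vec d I u \<in> tensors d I"
  by (simp add: tensor_of_vec_def tensors_def)

lemma vec_of_tensor_of_vec:
  assumes "d \<ge> 1" "u \<in> carrier_vec (tensor_size d I)"
  shows "vec_of_tensor d I (tensor_of_vec d I u) = u"
  \<comment> \<open>Entry \<open>m\<close> is looked up at \<open>(m + 1) - 1\<close>, so the two
    shifts cancel.\<close>
  using assms multi_index_of_in_multi_indices[OF assms(1)]
    linear_index_multi_index_of[OF assms(1)]
  by (intro eq_vecI) (simp_all add: vec_of_tensor_def tensor_of_vec_def)

text \<open>A right inverse of an injective map is also a left inverse: both sides have the same
  vectorization.\<close>

lemma tensor_of_vec_of_tensor:
  assumes "d \<ge> 1" "U \<in> tensors d I"
  shows "tensor_of_vec d I (vec_of_tensor d I U) = U"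
  by (rule inj_onD[OF inj_on_vec_of_tensor[OF assms(1)], of I])
    (simp_all add: assms(2) tensor_of_vec_in_tensors vec_of_tensor_of_vec[OF assms(1)] carrier_vecI)

lemma vec_of_apply_tensor:
  assumes "d \<ge> 1"
  shows "vec_of_tensor d I (apply_tensor d I A U) = matrix_of_tensor d I A *\<^sub>v vec_of_tensor d I U"
proof (rule eq_vecI)
  fix n assume "n < dim_vec (matrix_of_tensor d I A *\<^sub>v vec_of_tensor d I U)"
  then have n: "n < tensor_size d I" by (simp add: matrix_of_tensor_def)
  let ?i = "multi_index_of d I (n + 1)"
  have "vec_of_tensor d I (apply_tensor d I A U) $ n = (\<Sum>j\<in>multi_indices d I. A ?i j * U j)"
    using n multi_index_of_in_multi_indices[OF assms n]
    by (simp add: vec_of_tensor_def apply_tensor_def)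
  also have "\<dots> = (\<Sum>m = 0..<tensor_size d I.
      A ?i (multi_index_of d I (m + 1)) * U (multi_index_of d I (m + 1)))"
    \<comment> \<open>The reindexed sum is the scalar product of row \<open>n\<close> of the matrix
      with the vector.\<close>
    by (rule sum.reindex_bij_betw[OF bij_betw_multi_index_of[OF assms], symmetric])
  also have "\<dots> = (matrix_of_tensor d I A *\<^sub>v vec_of_tensor d I U) $ n"
    using n by (simp add: matrix_of_tensor_def vec_of_tensor_def scalar_prod_def)
  finally show "vec_of_tensor d I (apply_tensor d I A U) $ n =
      (matrix_of_tensor d I A *\<^sub>v vec_of_tensor d I U) $ n" .
qed (simp add: matrix_of_tensor_def)

lemma vec_of_scale_tensor:
  assumes "d \<ge> 1"
  shows "vec_of_tensor d I (scale_tensor d I c U) = c \<cdot>\<^sub>v vec_of_tensor d I U"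
  using multi_index_of_in_multi_indices[OF assms]
  by (intro eq_vecI) (simp_all add: vec_of_tensor_def scale_tensor_def)

text \<open>Transfers the nonzero clause of the eigentensor definition; injectivity leaves the zero
  tensor as the only preimage of the zero vector.\<close>

lemma vec_of_tensor_eq_zero_iff:
  assumes "d \<ge> 1" "U \<in> tensors d I"
  shows "vec_of_tensor d I U = 0\<^sub>v (tensor_size d I) \<longleftrightarrow> U = zero_tensor d I"
proof -
  have "vec_of_tensor d I (zero_tensor d I) = 0\<^sub>v (tensor_size d I)"
    using multi_index_of_in_multi_indices[OF assms(1)]
    by (intro eq_vecI) (simp_all add: vec_of_tensor_def zero_tensor_def)
  moreover have "zero_tensor d I \<in> tensors d I"
    by (simp add: zero_tensor_def tensors_def)
  ultimately show ?thesis
    using inj_on_eq_iff[OF inj_on_vec_of_tensor[OF assms(1)]] assms(2) by metis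
qed

text \<open>Both sides of the tensor equation are restricted to multi-indices, hence tensors, so
  injectivity makes their equality equivalent to that of their vectorizations.\<close>

lemma tensor_eigen_equation_iff:
  assumes "d \<ge> 1"
  shows "apply_tensor d I A U = scale_tensor d I c U \<longleftrightarrow>
    matrix_of_tensor d I A *\<^sub>v vec_of_tensor d I U = c \<cdot>\<^sub>v vec_of_tensor d I U"
proof -
  have "apply_tensor d I A U \<in> tensors d I" "scale_tensor d I c U \<in> tensors d I"
    by (simp_all add: apply_tensor_def scale_tensor_def tensors_def)
  from inj_on_eq_iff[OF inj_on_vec_of_tensor[OF assms] this] show ?thesis
    by (simp only: vec_of_apply_tensor[OF assms] vec_of_scale_tensor[OF assms])
qed

lemma eigentensor_iff_eigenvector:
  assumes "d \<ge> 1" "U \<in> tensors d I"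
  shows "eigentensor d I A U c \<longleftrightarrow> eigenvector (matrix_of_tensor d I A) (vec_of_tensor d I U) c"
proof -
  have "dim_row (matrix_of_tensor d I A) = tensor_size d I" by (simp add: matrix_of_tensor_def)
  then show ?thesis
    using assms vec_of_tensor_eq_zero_iff[OF assms]
    by (simp add: eigentensor_def eigenvector_def tensor_eigen_equation_iff carrier_vecI)
qed

lemma eigentensors_eq:
  assumes "d \<ge> 1"
  shows "{U. eigentensor d I A U c} =
    {tensor_of_vec d I u | u. eigenvector (matrix_of_tensor d I A) u c}"
proof (intro equalityI subsetI)
  fix U assume "U \<in> {U. eigentensor d I A U c}"
  then have "U \<in> tensors d I" "eigentensor d I A U c" by (simp_all add: eigentensor_def)
  \<comment> \<open>The witness for \<open>u\<close> is the vectorization of \<open>U\<close>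
    itself.\<close>
  then have "U = tensor_of_vec d I (vec_of_tensor d I U)"
    "eigenvector (matrix_of_tensor d I A) (vec_of_tensor d I U) c"
    using assms by (simp_all add: tensor_of_vec_of_tensor eigentensor_iff_eigenvector)
  then show "U \<in> {tensor_of_vec d I u | u. eigenvector (matrix_of_tensor d I A) u c}" by blast
next
  fix U assume "U \<in> {tensor_of_vec d I u | u. eigenvector (matrix_of_tensor d I A) u c}"
  then obtain u where u: "U = tensor_of_vec d I u" "eigenvector (matrix_of_tensor d I A) u c"
    by blast
  \<comment> \<open>Being an eigenvector fixes the dimension of \<open>u\<close>, which the round
    trip through tensors requires.\<close>
  then have "u \<in> carrier_vec (tensor_size d I)"
    by (simp add: eigenvector_def matrix_of_tensor_def)
  then show "U \<in> {U. eigentensor d I A U c}"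
    using assms u
    by (simp add: eigentensor_iff_eigenvector tensor_of_vec_in_tensors vec_of_tensor_of_vec)
qed

lemma transpose_matrix_of_tensor:
  assumes "d \<ge> 1" "self_adjoint d I A"
  shows "transpose_mat (matrix_of_tensor d I A) = matrix_of_tensor d I A"
proof (rule eq_matI)
  fix n m assume "n < dim_row (matrix_of_tensor d I A)" "m < dim_col (matrix_of_tensor d I A)"
  then have "n < tensor_size d I" "m < tensor_size d I" by (simp_all add: matrix_of_tensor_def)
  \<comment> \<open>Self-adjointness applies because both positions decode to genuine
    multi-indices.\<close>
  then show "transpose_mat (matrix_of_tensor d I A) $$ (n, m) = matrix_of_tensor d I A $$ (n, m)"
    using assms(2) multi_index_of_in_multi_indices[OF assms(1)]
    by (simp add: matrix_of_tensor_def self_adjoint_def)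
qed (simp_all add: matrix_of_tensor_def)

theorem mainTheorem1:
  fixes d :: nat and I :: "nat \<Rightarrow> nat" and A :: tensor2
  assumes "d \<ge> 1"
    and "\<forall>k\<in>{1..d}. I k \<ge> 1"
    and "self_adjoint d I A"
  shows "transpose_mat (matrix_of_tensor d I A) = matrix_of_tensor d I A
    \<and> (\<forall>c::real. \<forall>U\<in>tensors d I.
          apply_tensor d I A U = scale_tensor d I c U \<longleftrightarrow>
          matrix_of_tensor d I A *\<^sub>v vec_of_tensor d I U = c \<cdot>\<^sub>v vec_of_tensor d I U)
    \<and> (\<forall>c::real.
          {U. eigentensor d I A U c} =
          {tensor_of_vec d I u | u. eigenvector (matrix_of_tensor d I A) u c})"
  using transpose_matrix_of_tensor[OF assms(1,3)] tensor_eigen_equation_iff[OF assms(1)]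
    eigentensors_eq[OF assms(1)]
  by (intro conjI allI ballI)

end
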